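(* Over a parabola-inscribed Steiner-Soddy family of triangles ($N=3$), the locus of the orthocenter $X_4$ is a line parallel to the directrix of the parabola.
   Context: Setting ($N=3$). Let $R>0$. For $\varphi\in\mathbb{R}$ consider the three circles of radius $R\sin(\pi/3)$ centered at the vertices $R(\cos(\varphi+2\pi i/3),\sin(\varphi+2\pi i/3))$, $i=1,2,3$, of an equilateral triangle. They are pairwise tangent and are all tangent to the two circles $S_{reg}$, $S'_{reg}$ centered at the origin with radii $R(1-\sin(\pi/3))$ and $R(1+\sin(\pi/3))$. Fix an inversion circle with center $Q$ and radius $\lambda>0$. The images of the three circles under this inversion form a Steiner chain; letting $\varphi$ vary (with $R,Q,\lambda$ fixed) gives the Steiner porism, where values of $\varphi$ for which $Q$ lies on one of the three circles are excluded. The Steiner-Soddy triangle has as vertices the centers of the three circles of the chain. The family is parabola-inscribed, meaning that all these triangles are inscribed in one fixed parabola, when $Q$ lies on $S_{reg}$ or on $S'_{reg}$. The locus of the orthocenter is the set of orthocenters of the triangles of the family. *)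

theory Defs
  imports "HOL-Analysis.Analysis"
begin

text \<open>The Euclidean plane is the type \<^typ>\<open>complex\<close>.\<close>

definition inversion :: "complex \<Rightarrow> real \<Rightarrow> complex \<Rightarrow> complex" where
  "inversion Q l z = Q + (l\<^sup>2 / (dist Q z)\<^sup>2) *\<^sub>R (z - Q)"

definition circle_center :: "complex set \<Rightarrow> complex" where
  "circle_center S = (THE c. \<exists>r>0. S = sphere c r)"

definition base_vertex :: "real \<Rightarrow> real \<Rightarrow> nat \<Rightarrow> complex" where
  "base_vertex R \<phi> i = of_real R * cis (\<phi> + 2 * pi * real i / 3)"

definition base_circle :: "real \<Rightarrow> real \<Rightarrow> nat \<Rightarrow> complex set" where
  "base_circle R \<phi> i = sphere (base_vertex R \<phi> i) (R * sin (pi / 3))"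

text \<open>The two circles tangent to all three base circles.\<close>

definition S_reg :: "real \<Rightarrow> complex set" where
  "S_reg R = sphere 0 (R * (1 - sin (pi / 3)))"

definition S_reg' :: "real \<Rightarrow> complex set" where
  "S_reg' R = sphere 0 (R * (1 + sin (pi / 3)))"

definition admissible :: "real \<Rightarrow> complex \<Rightarrow> real set" where
  "admissible R Q = {\<phi>. \<forall>i\<in>{1..3}. Q \<notin> base_circle R \<phi> i}"

definition chain_circle :: "real \<Rightarrow> complex \<Rightarrow> real \<Rightarrow> real \<Rightarrow> nat \<Rightarrow> complex set" where
  "chain_circle R Q l \<phi> i = inversion Q l ` base_circle R \<phi> i"

text \<open>The vertices of the Steiner-Soddy triangle are the centers of the inverted circles, which
  differ from the inverses of the centers. The definition is meaningful for
  \<^term>\<open>\<phi> \<in> admissible R Q\<close> and \<^term>\<open>i \<in> {1..3}\<close>; see \<open>ss_vertex_eq\<close> below.\<close>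

definition ss_vertex :: "real \<Rightarrow> complex \<Rightarrow> real \<Rightarrow> real \<Rightarrow> nat \<Rightarrow> complex" where
  "ss_vertex R Q l \<phi> i = circle_center (chain_circle R Q l \<phi> i)"

definition is_line :: "complex set \<Rightarrow> bool" where
  "is_line L \<longleftrightarrow> affine L \<and> aff_dim L = 1"

definition parabola :: "complex \<Rightarrow> complex set \<Rightarrow> complex set" where
  "parabola F d = {P. dist P F = infdist P d}"

definition parabola_inscribed ::
  "real \<Rightarrow> complex \<Rightarrow> real \<Rightarrow> complex \<Rightarrow> complex set \<Rightarrow> bool" where
  "parabola_inscribed R Q l F d \<longleftrightarrow>
     is_line d \<and> F \<notin> d \<and>
     (\<forall>\<phi>\<in>admissible R Q. \<forall>i\<in>{1..3}. ss_vertex R Q l \<phi> i \<in> parabola F d)"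

text \<open>\<open>H\<close> lies on the three altitudes of the triangle \<open>A B C\<close>.\<close>

definition is_orthocenter :: "complex \<Rightarrow> complex \<Rightarrow> complex \<Rightarrow> complex \<Rightarrow> bool" where
  "is_orthocenter H A B C \<longleftrightarrow>
     (H - A) \<bullet> (B - C) = 0 \<and> (H - B) \<bullet> (C - A) = 0 \<and> (H - C) \<bullet> (A - B) = 0"

definition orthocenter_locus :: "real \<Rightarrow> complex \<Rightarrow> real \<Rightarrow> complex set" where
  "orthocenter_locus R Q l =
     {H. \<exists>\<phi>\<in>admissible R Q.
        is_orthocenter H (ss_vertex R Q l \<phi> 1) (ss_vertex R Q l \<phi> 2) (ss_vertex R Q l \<phi> 3)}"


lemma circle_center_sphere:
  assumes "r > 0"
  shows "circle_center (sphere c r) = c"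
  unfolding circle_center_def
proof (rule the_equality)
  show "\<exists>r'>0. sphere c r = sphere c r'" using assms by blast
next
  fix c' assume "\<exists>r'>0. sphere c r = sphere c' r'"
  then obtain r' where r': "r' > 0" "sphere c r = sphere c' r'" by blast
  have eq: "dist c z = r \<longleftrightarrow> dist c' z = r'" for z
    using r'(2) by (metis mem_sphere)
  have eq2: "(Re c - x)\<^sup>2 + (Im c - y)\<^sup>2 = r\<^sup>2 \<longleftrightarrow> (Re c' - x)\<^sup>2 + (Im c' - y)\<^sup>2 = r'\<^sup>2" for x y
    using eq[of "Complex x y"] assms r'(1)
    by (simp add: dist_norm cmod_def real_sqrt_eq_iff)
       (smt (verit, best) real_sqrt_abs real_sqrt_pow2 sum_power2_ge_zero)
  have "(Re c' - (Re c + r))\<^sup>2 + (Im c' - Im c)\<^sup>2 = r'\<^sup>2"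
    "(Re c' - (Re c - r))\<^sup>2 + (Im c' - Im c)\<^sup>2 = r'\<^sup>2"
    "(Re c' - Re c)\<^sup>2 + (Im c' - (Im c + r))\<^sup>2 = r'\<^sup>2"
    "(Re c' - Re c)\<^sup>2 + (Im c' - (Im c - r))\<^sup>2 = r'\<^sup>2"
    by (simp_all flip: eq2)
  then have "r * (Re c' - Re c) = 0" "r * (Im c' - Im c) = 0"
    by algebra+
  then show "c' = c" using assms by (simp add: complex_eq_iff)
qed

lemma inversion_involution:
  assumes "l > 0" "z \<noteq> Q"
  shows "inversion Q l (inversion Q l z) = z"
proof -
  define v where "v = z - Q"
  have "v \<noteq> 0" using assms by (simp add: v_def)
  have "inversion Q l z - Q = (l\<^sup>2 / (norm v)\<^sup>2) *\<^sub>R v"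
    by (simp add: inversion_def v_def dist_norm norm_minus_commute)
  moreover from this have "(dist Q (inversion Q l z))\<^sup>2 = l^4 / (norm v)\<^sup>2"
    using \<open>v \<noteq> 0\<close> by (simp add: dist_norm norm_minus_commute[of Q] power_mult_distrib
      power_divide field_simps)
  ultimately show ?thesis
    unfolding inversion_def[of Q l "inversion Q l z"] using assms \<open>v \<noteq> 0\<close>
    by (simp add: v_def power_mult_distrib power2_eq_square power4_eq_xxxx)
qed

lemma inversion_mem_sphere:
  assumes "l > 0" "r > 0" "(norm (c - Q))\<^sup>2 \<noteq> r\<^sup>2" "z \<in> sphere c r"
  defines "D \<equiv> (norm (c - Q))\<^sup>2 - r\<^sup>2"
  shows "inversion Q l z \<in> sphere (Q + (l\<^sup>2 / D) *\<^sub>R (c - Q)) (l\<^sup>2 * r / \<bar>D\<bar>)"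
proof -
  define v a where "v = z - Q" and "a = c - Q"
  have r: "norm (a - v) = r" using assms(4) by (simp add: dist_norm a_def v_def)
  have D: "D \<noteq> 0" "(norm a)\<^sup>2 = D + r\<^sup>2" using assms(3) by (simp_all add: D_def a_def)
  have "v \<noteq> 0" using r assms(3) by (auto simp: a_def)
  define n where "n = (norm v)\<^sup>2"
  have n: "n \<noteq> 0" "(norm v)\<^sup>2 = n" using \<open>v \<noteq> 0\<close> by (simp_all add: n_def)
  have av: "2 * (a \<bullet> v) = D + n"
    using r D n by (simp add: power2_norm_eq_inner inner_diff algebra_simps inner_commute
        flip: r)
  have "(dist (Q + (l\<^sup>2 / D) *\<^sub>R a) (Q + (l\<^sup>2 / n) *\<^sub>R v))\<^sup>2
      = (l\<^sup>2 / D)\<^sup>2 * (norm a)\<^sup>2 - (l\<^sup>2 / D) * (l\<^sup>2 / n) * (2 * (a \<bullet> v)) + (l\<^sup>2 / n)\<^sup>2 * (norm v)\<^sup>2"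
    by (simp add: dist_norm power2_norm_eq_inner inner_diff inner_commute algebra_simps
        power2_eq_square[of "l\<^sup>2 / D"] power2_eq_square[of "l\<^sup>2 / n"])
  also have "\<dots> = (l\<^sup>2 * r / \<bar>D\<bar>)\<^sup>2"
    unfolding av D(2) n(2) using D(1) n(1)
    by (simp add: power_divide power_mult_distrib) (simp add: field_simps power2_eq_square)
  finally have "dist (Q + (l\<^sup>2 / D) *\<^sub>R a) (Q + (l\<^sup>2 / n) *\<^sub>R v) = l\<^sup>2 * r / \<bar>D\<bar>"
    by (rule power2_eq_imp_eq) (use assms(2) in auto)
  then show ?thesis
    by (simp add: inversion_def dist_norm norm_minus_commute[of Q z] n_def v_def a_def)
qed

lemma inversion_image_sphere:
  assumes "l > 0" "r > 0" "Q \<notin> sphere c r"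
  defines "D \<equiv> (norm (c - Q))\<^sup>2 - r\<^sup>2"
  shows "inversion Q l ` sphere c r = sphere (Q + (l\<^sup>2 / D) *\<^sub>R (c - Q)) (l\<^sup>2 * r / \<bar>D\<bar>)"
proof -
  define c' r' where "c' = Q + (l\<^sup>2 / D) *\<^sub>R (c - Q)" and "r' = l\<^sup>2 * r / \<bar>D\<bar>"
  have ne: "(norm (c - Q))\<^sup>2 \<noteq> r\<^sup>2"
    using assms(2,3) by (auto simp: dist_norm)
  then have D: "D \<noteq> 0" by (simp add: D_def)
  have r': "r' > 0" using assms D by (simp add: r'_def)
  have D': "(norm (c' - Q))\<^sup>2 - r'\<^sup>2 = l^4 / D"
  proof -
    have "(norm (c' - Q))\<^sup>2 = (l\<^sup>2 / D)\<^sup>2 * (norm (c - Q))\<^sup>2" "r'\<^sup>2 = (l\<^sup>2 / D)\<^sup>2 * r\<^sup>2"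
      by (simp_all add: c'_def r'_def power_mult_distrib power_divide)
    then have "(norm (c' - Q))\<^sup>2 - r'\<^sup>2 = (l\<^sup>2 / D)\<^sup>2 * D"
      by (simp only: D_def right_diff_distrib)
    then show ?thesis using D by (simp add: power2_eq_square power4_eq_xxxx)
  qed
  have ne': "(norm (c' - Q))\<^sup>2 \<noteq> r'\<^sup>2" using D' D assms(1) by auto
  have inv_back: "Q + (l\<^sup>2 / (l^4 / D)) *\<^sub>R (c' - Q) = c" "l\<^sup>2 * r' / \<bar>l^4 / D\<bar> = r"
    using D assms(1) by (simp_all add: c'_def r'_def power2_eq_square power4_eq_xxxx abs_mult)
  show ?thesis unfolding c'_def[symmetric] r'_def[symmetric]
  proof
    show "inversion Q l ` sphere c r \<subseteq> sphere c' r'"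
      using inversion_mem_sphere[OF assms(1,2) ne] unfolding c'_def r'_def D_def by blast
  next
    show "sphere c' r' \<subseteq> inversion Q l ` sphere c r"
    proof
      fix w assume w: "w \<in> sphere c' r'"
      have "inversion Q l w \<in> sphere c r"
        using inversion_mem_sphere[OF assms(1) r' ne' w] unfolding D' inv_back .
      moreover have "w \<noteq> Q" using w ne' by (auto simp: dist_norm)
      ultimately show "w \<in> inversion Q l ` sphere c r"
        using inversion_involution[OF assms(1)] by (metis image_eqI)
    qed
  qed
qed

lemma ss_vertex_eq:
  assumes "R > 0" "l > 0" "\<phi> \<in> admissible R Q" "i \<in> {1..3}"
  defines "c \<equiv> base_vertex R \<phi> i"
  shows "ss_vertex R Q l \<phi> i
           = Q + (l\<^sup>2 / ((norm (c - Q))\<^sup>2 - (R * sin (pi / 3))\<^sup>2)) *\<^sub>R (c - Q)"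
proof -
  have r: "R * sin (pi / 3) > 0" using assms(1) by (simp add: sin_60)
  have Q: "Q \<notin> sphere c (R * sin (pi / 3))"
    using assms(3,4) by (auto simp: admissible_def base_circle_def c_def)
  from Q have "(norm (c - Q))\<^sup>2 \<noteq> (R * sin (pi / 3))\<^sup>2"
    using r by (auto simp: dist_norm simp del: power_mult_distrib)
  then have "l\<^sup>2 * (R * sin (pi / 3)) / \<bar>(norm (c - Q))\<^sup>2 - (R * sin (pi / 3))\<^sup>2\<bar> > 0"
    using r assms(2) by simp
  then show ?thesis
    unfolding ss_vertex_def chain_circle_def base_circle_def c_def[symmetric]
      inversion_image_sphere[OF assms(2) r Q]
    by (rule circle_center_sphere)
qed

lemma is_line_hyperplane:
  assumes "norm u = 1"
  shows "is_line {z. u \<bullet> z = b}"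
proof -
  have "u \<noteq> 0" using assms by auto
  then show ?thesis
    using aff_dim_hyperplane[of u b] by (simp add: is_line_def affine_hyperplane)
qed

lemma infdist_line:
  assumes "norm u = 1"
  shows "infdist z {z. u \<bullet> z = b} = \<bar>u \<bullet> z - b\<bar>"
proof -
  have uu: "u \<bullet> u = 1" using assms by (simp add: dot_square_norm)
  define p where "p = z - (u \<bullet> z - b) *\<^sub>R u"
  have p: "p \<in> {z. u \<bullet> z = b}" by (simp add: p_def inner_diff uu)
  have le: "\<bar>u \<bullet> z - b\<bar> \<le> dist z y" if "y \<in> {z. u \<bullet> z = b}" for y
    using that Cauchy_Schwarz_ineq2[of u "z - y"] assms by (simp add: inner_diff dist_norm)
  have "infdist z {z. u \<bullet> z = b} \<le> \<bar>u \<bullet> z - b\<bar>"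
    using infdist_le[OF p, of z] assms by (simp add: p_def dist_norm)
  moreover have "\<bar>u \<bullet> z - b\<bar> \<le> infdist z {z. u \<bullet> z = b}"
    unfolding infdist_def using p le by (auto intro!: cINF_greatest)
  ultimately show ?thesis by simp
qed

text \<open>Steiner-Soddy families inscribed in a parabola exist: it suffices that \<open>Q\<close> lies on one of the
  two circles tangent to all base circles.\<close>

lemma parabola_inscribed_S_reg:
  assumes "R > 0" "l > 0" "Q \<in> S_reg R \<union> S_reg' R"
  shows "\<exists>F d. parabola_inscribed R Q l F d"
proof -
  define s :: real where "s = sin (pi / 3)"
  have s: "s\<^sup>2 = 3 / 4" "0 < s" "s < 1"
    by (simp_all add: s_def sin_60 power_divide real_less_lsqrt)
  obtain e where e: "e = 1 \<or> e = - 1" "norm Q = R * (1 + e * s)"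
    using assms(3) by (force simp: S_reg_def S_reg'_def s_def)
  define q u where "q = norm Q" and "u = sgn Q"
  have q: "q = R * (1 + e * s)" "q > 0"
    using e s assms(1) by (auto simp: q_def)
  have nu: "norm u = 1" and Qu: "Q = q *\<^sub>R u"
    using q(2) by (auto simp: u_def q_def norm_sgn sgn_div_norm)
  have uu: "(Re u)\<^sup>2 + (Im u)\<^sup>2 = 1"
    using nu cmod_power2[of u] by simp
  define k where "k = l\<^sup>2 / (2 * q)"
  define p where "p = - (e * s * k / 2)"
  have k: "k > 0" using assms(2) q(2) by (simp add: k_def)
  have p: "p \<noteq> 0" using k s e by (auto simp: p_def)
  have p2: "2 * p = - (e * s * k)" by (simp add: p_def)
  define f where "f = k\<^sup>2 / (4 * p)"
  have f: "f \<noteq> 0" "4 * p * f = k\<^sup>2" using k p by (simp_all add: f_def)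
  define F where "F = Q + (p - k + f) *\<^sub>R u"
  define b where "b = q + p - k - f"
  define d where "d = {z. u \<bullet> z = b}"
  have u1: "u \<bullet> u = 1" using nu by (simp add: dot_square_norm)
  have uQ: "u \<bullet> Q = q" by (subst Qu) (simp add: u1)
  have "F \<notin> d"
    using f(1) by (simp add: d_def F_def uQ b_def inner_add_right u1)
  moreover have "ss_vertex R Q l \<phi> i \<in> parabola F d"
    if \<phi>: "\<phi> \<in> admissible R Q" "i \<in> {1..3}" for \<phi> i
  proof -
    define c where "c = base_vertex R \<phi> i"
    define C S where "C = u \<bullet> cis (\<phi> + 2 * pi * real i / 3)"
      and "S = (\<i> * u) \<bullet> cis (\<phi> + 2 * pi * real i / 3)"
    have cs: "C\<^sup>2 + S\<^sup>2 = 1"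
    proof -
      define z where "z = cis (\<phi> + 2 * pi * real i / 3)"
      have "C\<^sup>2 + S\<^sup>2 = ((Re u)\<^sup>2 + (Im u)\<^sup>2) * ((Re z)\<^sup>2 + (Im z)\<^sup>2)"
        unfolding C_def S_def z_def[symmetric] by (simp add: inner_complex_def) algebra
      then show ?thesis by (simp add: uu z_def)
    qed
    have cis: "cis (\<phi> + 2 * pi * real i / 3) = C *\<^sub>R u + S *\<^sub>R (\<i> * u)"
      unfolding C_def S_def using uu
      by (simp add: complex_eq_iff inner_complex_def) algebra
    have nrm: "(norm (x *\<^sub>R u + y *\<^sub>R (\<i> * u)))\<^sup>2 = x\<^sup>2 + y\<^sup>2" for x y
    proof -
      have "(norm (x *\<^sub>R u + y *\<^sub>R (\<i> * u)))\<^sup>2 = (x\<^sup>2 + y\<^sup>2) * ((Re u)\<^sup>2 + (Im u)\<^sup>2)"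
        by (simp add: cmod_power2) algebra
      then show ?thesis by (simp add: uu)
    qed
    have cQ: "c - Q = (R * C - q) *\<^sub>R u + (R * S) *\<^sub>R (\<i> * u)"
      unfolding c_def base_vertex_def cis Qu
      by (simp add: scaleR_conv_of_real algebra_simps)
    define D where "D = (norm (c - Q))\<^sup>2 - (R * s)\<^sup>2"
    have D: "D = 2 * R * q * (1 - C)"
    proof -
      have ee: "e\<^sup>2 = 1" using e by auto
      have "D = (R * C - q)\<^sup>2 + (R * S)\<^sup>2 - (R * s)\<^sup>2" by (simp add: D_def cQ nrm)
      also have "\<dots> = R\<^sup>2 + q\<^sup>2 - 2 * R * q * C - R\<^sup>2 * s\<^sup>2" using cs by algebra
      also have "\<dots> = 2 * R * q * (1 - C)" using ee unfolding q(1) by algebra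
      finally show ?thesis .
    qed
    have D0: "D \<noteq> 0"
    proof -
      have "Q \<notin> sphere c (R * s)"
        using \<phi> by (auto simp: admissible_def base_circle_def c_def s_def)
      then have "norm (c - Q) \<noteq> R * s" by (simp add: dist_norm)
      then show ?thesis using assms(1) s(2) by (simp add: D_def)
    qed
    have C1: "1 - C \<noteq> 0" using D D0 by auto
    define X Y where "X = l\<^sup>2 / D * (R * C - q)" and "Y = l\<^sup>2 / D * (R * S)"
    define t where "t = S / (1 - C)"
    have t: "S = t * (1 - C)" "(1 + t\<^sup>2) * (1 - C) = 2"
    proof -
      show S: "S = t * (1 - C)" using C1 by (simp add: t_def)
      have "(1 - C) * ((1 + t\<^sup>2) * (1 - C)) = (1 - C) * 2"
        using cs unfolding S by algebra
      then show "(1 + t\<^sup>2) * (1 - C) = 2" using C1 by (metis mult_cancel_left)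
    qed
    have Y: "Y = k * t"
      using C1 assms(1) q(2) by (simp add: Y_def D k_def t_def field_simps)
    have X: "X = p - k + p * t\<^sup>2"
    proof -
      have "X * (1 - C) = k * (C - 1 - e * s)"
        using C1 assms(1) q(2) unfolding X_def D k_def
        by (simp add: field_simps) (simp add: q(1) algebra_simps)
      also have "\<dots> = p * 2 - k * (1 - C)"
        using p2 by (simp add: algebra_simps)
      also have "\<dots> = (p - k + p * t\<^sup>2) * (1 - C)"
        unfolding t(2)[symmetric] by (simp add: algebra_simps)
      finally show ?thesis using C1 by simp
    qed
    have V: "ss_vertex R Q l \<phi> i = Q + (X *\<^sub>R u + Y *\<^sub>R (\<i> * u))"
      unfolding ss_vertex_eq[OF assms(1,2) \<phi>] c_def[symmetric] s_def[symmetric] D_def[symmetric]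
      by (simp add: cQ X_def Y_def scaleR_add_right)
    have iu: "u \<bullet> (\<i> * u) = 0" by (simp add: inner_complex_def)
    have "ss_vertex R Q l \<phi> i - F = (X - (p - k + f)) *\<^sub>R u + Y *\<^sub>R (\<i> * u)"
      unfolding V F_def by (simp add: algebra_simps)
    then have "(dist (ss_vertex R Q l \<phi> i) F)\<^sup>2 = (X - (p - k + f))\<^sup>2 + Y\<^sup>2"
      by (simp only: dist_norm nrm)
    also have "\<dots> = (X - (p - k - f))\<^sup>2"
      unfolding X Y using f(2) by algebra
    also have "X - (p - k - f) = u \<bullet> ss_vertex R Q l \<phi> i - b"
      by (simp add: V uQ b_def inner_add_right u1 iu)
    finally have "dist (ss_vertex R Q l \<phi> i) F = \<bar>u \<bullet> ss_vertex R Q l \<phi> i - b\<bar>"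
      by (metis abs_of_nonneg real_sqrt_abs zero_le_dist)
    then show ?thesis by (simp add: parabola_def d_def infdist_line[OF nu])
  qed
  moreover have "is_line d" unfolding d_def by (rule is_line_hyperplane[OF nu])
  ultimately show ?thesis unfolding parabola_inscribed_def by blast
qed

end

theory Submission
  imports Defs "HOL-Computational_Algebra.Polynomial"
begin

text \<open>
  Write \<open>c\<close> for a center of a base circle; it moves on the circle \<open>\<bar>c\<bar> = R\<close>. Since the base circles
  have squared radius \<open>3 R\<^sup>2 / 4\<close>, the corresponding vertex of the Steiner-Soddy triangle is
  \<open>Q + (l\<^sup>2 / D) (c - Q)\<close> with \<open>D = R\<^sup>2 / 4 + \<bar>Q\<bar>\<^sup>2 - 2 (c \<bullet> Q)\<close>, a projective image of \<open>c\<close> that is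
  sent to infinity exactly when \<open>D = 0\<close>.

  Only the existence of a circumscribed parabola is assumed, so the first task is to find where \<open>Q\<close>
  lies and how the directrix is placed. A parabola touches the line at infinity, at the point given by
  its axis. Hence the line \<open>D = 0\<close> touches the circle \<open>\<bar>c\<bar> = R\<close>, necessarily at the multiple \<open>R Q / \<bar>Q\<bar>\<close>
  of \<open>Q\<close>. The tangency says \<open>\<bar>Q\<bar>\<^sup>2 + R\<^sup>2 / 4 = 2 R \<bar>Q\<bar>\<close>, which is the condition that \<open>Q\<close> lies on one of
  the two circles tangent to all base circles, and the axis is parallel to \<open>Q\<close>. This is
  \<open>parabola_inscribed_tangent\<close>, with the computation in \<open>parabola_circle_image_tangent\<close>.

  Conversely, for such a \<open>Q\<close> take orthonormal coordinates whose first axis points along \<open>Q\<close>. In terms of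
  the half angle \<open>\<theta>\<close> between \<open>c\<close> and \<open>Q\<close>, the vertices are \<open>(p t\<^sup>2, k t)\<close> up to a fixed translation,
  where \<open>t = cot \<theta>\<close>, \<open>k = l\<^sup>2 / (2 \<bar>Q\<bar>)\<close> and \<open>16 p\<^sup>2 = 3 k\<^sup>2\<close>. The three half angles of one triangle differ
  by \<open>\<pi> / 3\<close>, so its three parameters are the roots of \<open>t\<^sup>3 - 3 T t\<^sup>2 - 3 t + T\<close> with \<open>T = cot (3 \<theta>)\<close>
  (\<open>cot_thirds\<close>). The orthocenter of a triangle inscribed in a parabola is an explicit function of the
  elementary symmetric functions \<open>e\<^sub>1, e\<^sub>2, e\<^sub>3\<close> of its parameters, and its coordinate along the axis
  depends on \<open>e\<^sub>2\<close> only (\<open>orthocenter_of_parabola_triangle\<close>). Here \<open>e\<^sub>2 = - 3\<close> is constant, so the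
  orthocenter stays on a perpendicular to the axis, that is, on a parallel to the directrix. Its other
  coordinate is \<open>3 k T / 2\<close>; as \<open>T\<close> takes all real values over the family, the whole line is covered.
\<close>

section \<open>Conics meeting a circle in infinitely many points\<close>

text \<open>A case of Bezout's theorem: a conic that shares infinitely many points with a circle is a multiple
  of that circle. On the circle the conjugate of \<open>z\<close> is \<open>R\<^sup>2 / z\<close>, so that multiplication by \<open>4 z\<^sup>2\<close>
  turns the equation of the conic into a complex polynomial of degree at most four with infinitely many
  roots.\<close>

lemma quadric_vanishing_on_circle:
  fixes a b c d e f R :: real
  assumes inf: "infinite {z. norm z = R \<and> a * (Re z)\<^sup>2 + b * (Re z * Im z) + c * (Im z)\<^sup>2 + d * Re z + e * Im z + f = 0}"
  shows "b = 0" "c = a" "d = 0" "e = 0" "f = - (a * R\<^sup>2)"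
proof -
  define P :: "complex poly" where
    "P = [: Complex ((a - c) * R^4) (b * R^4), Complex (2 * d * R\<^sup>2) (2 * e * R\<^sup>2),
            of_real (2 * (a + c) * R\<^sup>2 + 4 * f), Complex (2 * d) (- 2 * e), Complex (a - c) (- b) :]"
  have "poly P z = 0"
    if "norm z = R" "a * (Re z)\<^sup>2 + b * (Re z * Im z) + c * (Im z)\<^sup>2 + d * Re z + e * Im z + f = 0" for z
  proof -
    obtain x y where z: "z = Complex x y" by (cases z)
    have R2: "R\<^sup>2 = x\<^sup>2 + y\<^sup>2" using that(1) cmod_power2[of z] by (simp add: z)
    have R4: "R^4 = (x\<^sup>2 + y\<^sup>2)\<^sup>2" by (simp flip: R2)
    have q: "a * x\<^sup>2 + b * (x * y) + c * y\<^sup>2 + d * x + e * y + f = 0" using that(2) by (simp add: z)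
    have f: "f = - (a * x\<^sup>2 + b * (x * y) + c * y\<^sup>2 + d * x + e * y)" using q by linarith
    show ?thesis
      unfolding P_def R4 R2 f z
      by (simp add: complex_eq_iff) (simp add: algebra_simps power2_eq_square)
  qed
  then have "infinite {z. poly P z = 0}"
    using inf by (auto elim!: infinite_super[rotated])
  then have "P = 0" using poly_roots_finite by blast
  then have "Complex (a - c) (- b) = 0" "Complex (2 * d) (- 2 * e) = 0"
      "of_real (2 * (a + c) * R\<^sup>2 + 4 * f) = (0::complex)"
    by (simp_all add: P_def split: if_splits)
  then show "b = 0" "c = a" "d = 0" "e = 0" "f = - (a * R\<^sup>2)"
    by (simp_all add: complex_eq_iff)
qed

lemma norm_diff_square:
  fixes z w :: complex
  shows "(norm (z - w))\<^sup>2 = (norm z)\<^sup>2 + (norm w)\<^sup>2 - 2 * (Re z * Re w + Im z * Im w)"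
  by (simp add: cmod_power2) (simp add: power2_eq_square algebra_simps)

lemma base_radius_square: "(R * sin (pi / 3))\<^sup>2 = 3 / 4 * R\<^sup>2"
  by (simp add: sin_60 power_mult_distrib power_divide)

text \<open>A forbidden center \<open>c\<close> lies, up to a rotation by a multiple of \<open>2 \<pi> / 3\<close>, on the line \<open>D = 0\<close>, which
  meets the circle in finitely many points. Admissible positions therefore abound, enough to determine
  a conic equation.\<close>

lemma infinite_admissible_vertices:
  assumes "R > 0"
  shows "infinite ((\<lambda>\<phi>. of_real R * cis \<phi>) ` admissible R Q)"
proof -
  define \<omega> where "\<omega> i = cis (2 * pi * real i / 3)" for i :: nat
  define B where "B i = {z. norm z = R \<and> norm (z * \<omega> i - Q) = R * sin (pi / 3)}" for i
  have "finite (B i)" for i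
  proof (rule ccontr)
    assume inf: "infinite (B i)"
    define v where "v = Q * cnj (\<omega> i)"
    have nv: "norm v = norm Q" by (simp add: v_def norm_mult \<omega>_def)
    have "B i \<subseteq> {z. norm z = R \<and> 0 * (Re z)\<^sup>2 + 0 * (Re z * Im z) + 0 * (Im z)\<^sup>2
        + (- 2 * Re v) * Re z + (- 2 * Im v) * Im z + (R\<^sup>2 / 4 + (norm v)\<^sup>2) = 0}"
    proof
      fix z assume z: "z \<in> B i"
      have "norm (z * \<omega> i - Q) = norm ((z - v) * \<omega> i)"
        by (simp add: v_def algebra_simps) (simp add: \<omega>_def cis_cnj cis_mult flip: mult.assoc)
      then have "norm (z - v) = R * sin (pi / 3)" using z by (simp add: norm_mult \<omega>_def B_def)
      then have "(norm (z - v))\<^sup>2 = 3 / 4 * R\<^sup>2" by (simp add: base_radius_square)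
      then show "z \<in> {z. norm z = R \<and> 0 * (Re z)\<^sup>2 + 0 * (Re z * Im z) + 0 * (Im z)\<^sup>2
        + (- 2 * Re v) * Re z + (- 2 * Im v) * Im z + (R\<^sup>2 / 4 + (norm v)\<^sup>2) = 0}"
        using z unfolding norm_diff_square B_def by (simp add: algebra_simps)
    qed
    from quadric_vanishing_on_circle(5)[OF infinite_super[OF this inf]]
    have "R\<^sup>2 / 4 + (norm v)\<^sup>2 = 0" by simp
    moreover have "R\<^sup>2 > 0" using assms by simp
    ultimately show False by (smt (verit) zero_le_power2 divide_pos_pos)
  qed
  then have "finite (\<Union>i\<in>{1..3}. B i)" by blast
  moreover have "infinite (sphere (0::complex) R)"
  proof
    assume "finite (sphere (0::complex) R)"
    moreover have "connected (sphere (0::complex) R)" by (rule connected_sphere) simp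
    ultimately have "sphere (0::complex) R = {} \<or> (\<exists>x. sphere (0::complex) R = {x})"
      by (metis connected_finite_iff_sing)
    moreover have "of_real R \<in> sphere (0::complex) R" "- of_real R \<in> sphere (0::complex) R"
      using assms by auto
    ultimately have "complex_of_real R = - of_real R" by (metis empty_iff singletonD)
    then show False using assms by (simp add: complex_eq_iff)
  qed
  ultimately have "infinite (sphere 0 R - (\<Union>i\<in>{1..3}. B i))" by (simp add: Diff_infinite_finite)
  moreover have "sphere 0 R - (\<Union>i\<in>{1..3}. B i) \<subseteq> (\<lambda>\<phi>. of_real R * cis \<phi>) ` admissible R Q"
  proof
    fix z assume z: "z \<in> sphere 0 R - (\<Union>i\<in>{1..3}. B i)"
    then have nz: "norm z = R" by simp
    have eq: "z = of_real R * cis (Arg z)" using nz by (metis rcis_cmod_Arg rcis_def)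
    have "base_vertex R (Arg z) i = z * \<omega> i" for i
      by (subst (2) eq) (simp add: base_vertex_def \<omega>_def cis_mult mult.assoc)
    then have "Arg z \<in> admissible R Q"
      using z nz by (auto simp: admissible_def base_circle_def B_def dist_norm)
    then show "z \<in> (\<lambda>\<phi>. of_real R * cis \<phi>) ` admissible R Q" using eq by blast
  qed
  ultimately show ?thesis using infinite_super by blast
qed

section \<open>Circumscribed parabolas\<close>

text \<open>Multiplication by a unit \<open>u\<close> rotates the standard frame, so \<open>z\<close> and \<open>w\<close> are the coordinates of the
  base vertex and of \<open>Q\<close> in the frame with first axis \<open>u\<close>. The same formula serves for the frame adapted
  to a parabola and for the one adapted to \<open>Q\<close>.\<close>

lemma ss_vertex_in_frame:
  assumes "R > 0" "l > 0" "\<phi> \<in> admissible R Q" "i \<in> {1..3}"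
    and "norm u = 1" "base_vertex R \<phi> i = u * z" "Q = u * w"
  defines "D \<equiv> R\<^sup>2 / 4 + (norm w)\<^sup>2 - 2 * (Re z * Re w + Im z * Im w)"
  shows "D \<noteq> 0" "ss_vertex R Q l \<phi> i = Q + u * ((l\<^sup>2 / D) *\<^sub>R (z - w))"
proof -
  have "norm (u * z) = R"
    unfolding assms(6)[symmetric] using assms(1) by (simp add: base_vertex_def norm_mult)
  then have nz: "norm z = R" using assms(5) by (simp add: norm_mult)
  have cQ: "base_vertex R \<phi> i - Q = u * (z - w)" by (simp add: assms(6,7) algebra_simps)
  have nrm: "norm (base_vertex R \<phi> i - Q) = norm (z - w)"
    unfolding cQ by (simp add: norm_mult assms(5))
  have D: "(norm (base_vertex R \<phi> i - Q))\<^sup>2 - (R * sin (pi / 3))\<^sup>2 = D"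
    unfolding nrm norm_diff_square base_radius_square nz D_def by simp
  have "R * sin (pi / 3) > 0" using assms(1) by (simp add: sin_60)
  moreover have "norm (base_vertex R \<phi> i - Q) \<noteq> R * sin (pi / 3)"
    using assms(3,4) by (auto simp: admissible_def base_circle_def dist_norm)
  ultimately show "D \<noteq> 0"
    unfolding D[symmetric] by (smt (verit) norm_ge_zero power2_eq_imp_eq)
  show "ss_vertex R Q l \<phi> i = Q + u * ((l\<^sup>2 / D) *\<^sub>R (z - w))"
    unfolding ss_vertex_eq[OF assms(1-4)] D unfolding cQ by simp
qed

text \<open>In a frame in which the directrix is the line \<open>Re = b\<close> and the focus is \<open>(f1, f2)\<close> (both relative to
  \<open>Q\<close>), clearing denominators in the equation of the parabola gives \<open>Y\<^sup>2 = D P\<close> on the circle, where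
  \<open>Y\<close>, \<open>P\<close> and \<open>D\<close> are affine functions of the center \<open>z\<close>. By \<open>quadric_vanishing_on_circle\<close>,
  \<open>Y\<^sup>2 - D P\<close> is \<open>\<kappa>\<close> times the equation of the circle. Pair both quadratic forms with
  the homogeneous point \<open>v\<close> where \<open>Y = D = 0\<close>: the polar of \<open>v\<close> with respect to
  \<open>Y\<^sup>2 - D P\<close> is proportional to \<open>D\<close>. So \<open>D = 0\<close> is the polar of \<open>v\<close> with respect to the circle as well,
  and it contains \<open>v\<close>: it is the tangent at \<open>v\<close>. This needs \<open>P\<close> to be nonzero at \<open>v\<close>. Otherwise
  the norm of \<open>w\<close> is \<open>R / 2\<close>, and all images lie on one line, which is incompatible with the
  parabola.\<close>

lemma parabola_circle_image_tangent:
  fixes R m f1 f2 b :: real and w :: complex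
  defines "D \<equiv> \<lambda>z. R\<^sup>2 / 4 + (norm w)\<^sup>2 - 2 * (Re z * Re w + Im z * Im w)"
  assumes "R > 0" "m > 0" "f1 \<noteq> b"
    and inf: "infinite {z. norm z = R \<and> D z \<noteq> 0 \<and>
      (m / D z * (Re z - Re w) - f1)\<^sup>2 + (m / D z * (Im z - Im w) - f2)\<^sup>2
        = (m / D z * (Re z - Re w) - b)\<^sup>2}"
  shows "Im w = 0" "(Re w)\<^sup>2 + R\<^sup>2 / 4 = 2 * R * \<bar>Re w\<bar>"
proof -
  define w1 w2 K where "w1 = Re w" and "w2 = Im w" and "K = R\<^sup>2 / 4 + (norm w)\<^sup>2"
  define r where "r = R\<^sup>2"
  have r: "r > 0" using assms(2) by (simp add: r_def)
  have K: "K = r / 4 + w1\<^sup>2 + w2\<^sup>2" by (simp add: K_def w1_def w2_def cmod_power2 r_def)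
  have K0: "K > 0" unfolding K using r by (smt (verit) divide_pos_pos zero_le_power2)
  define \<delta> g where "\<delta> = m * (f1 - b)" and "g = b\<^sup>2 - f1\<^sup>2"
  have \<delta>: "\<delta> \<noteq> 0" using assms by (simp add: \<delta>_def)
  (* Y = \<alpha> x + \<beta> y + \<gamma> and P = a x + e y + h, while D = K - 2 w1 x - 2 w2 y. *)
  define \<alpha> \<beta> \<gamma> where "\<alpha> = 2 * f2 * w1" and "\<beta> = m + 2 * f2 * w2" and "\<gamma> = - m * w2 - f2 * K"
  define a e h where "a = 2 * \<delta> - 2 * g * w1" and "e = - 2 * g * w2" and "h = g * K - 2 * \<delta> * w1"
  have sub: "{z. norm z = R \<and> D z \<noteq> 0 \<and>
      (m / D z * (Re z - Re w) - f1)\<^sup>2 + (m / D z * (Im z - Im w) - f2)\<^sup>2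
        = (m / D z * (Re z - Re w) - b)\<^sup>2} \<subseteq>
    {z. norm z = R \<and> (\<alpha>\<^sup>2 + 2 * w1 * a) * (Re z)\<^sup>2
      + (2 * \<alpha> * \<beta> + 2 * w1 * e + 2 * w2 * a) * (Re z * Im z) + (\<beta>\<^sup>2 + 2 * w2 * e) * (Im z)\<^sup>2
      + (2 * \<alpha> * \<gamma> - K * a + 2 * w1 * h) * Re z + (2 * \<beta> * \<gamma> - K * e + 2 * w2 * h) * Im z
      + (\<gamma>\<^sup>2 - K * h) = 0}"
  proof safe
    fix z assume D0: "D z \<noteq> 0" and eq: "(m / D z * (Re z - Re w) - f1)\<^sup>2
      + (m / D z * (Im z - Im w) - f2)\<^sup>2 = (m / D z * (Re z - Re w) - b)\<^sup>2"
    define x y E where "x = Re z" and "y = Im z" and "E = D z"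
    have E: "E = K - 2 * x * w1 - 2 * y * w2"
      by (simp add: E_def D_def K_def x_def y_def w1_def w2_def)
    define X Y where "X = m / E * (x - w1)" and "Y = m / E * (y - w2)"
    have XY: "E * X = m * (x - w1)" "E * Y = m * (y - w2)"
      using D0 by (simp_all add: X_def Y_def E_def)
    have "(X - f1)\<^sup>2 + (Y - f2)\<^sup>2 = (X - b)\<^sup>2"
      using eq by (simp add: X_def Y_def E_def x_def y_def w1_def w2_def)
    then have "(E * Y - f2 * E)\<^sup>2 = E * (2 * (f1 - b) * (E * X) + g * E)"
      unfolding g_def by algebra
    then have "(m * (y - w2) - f2 * E)\<^sup>2 = E * (2 * \<delta> * (x - w1) + g * E)"
      unfolding XY \<delta>_def by (simp add: algebra_simps)
    then show "(\<alpha>\<^sup>2 + 2 * w1 * a) * (Re z)\<^sup>2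
      + (2 * \<alpha> * \<beta> + 2 * w1 * e + 2 * w2 * a) * (Re z * Im z) + (\<beta>\<^sup>2 + 2 * w2 * e) * (Im z)\<^sup>2
      + (2 * \<alpha> * \<gamma> - K * a + 2 * w1 * h) * Re z + (2 * \<beta> * \<gamma> - K * e + 2 * w2 * h) * Im z
      + (\<gamma>\<^sup>2 - K * h) = 0"
      unfolding x_def[symmetric] y_def[symmetric] E \<alpha>_def \<beta>_def \<gamma>_def a_def e_def h_def
      by algebra
  qed
  note coeffs = quadric_vanishing_on_circle[OF infinite_super[OF sub inf]]
  define \<kappa> where "\<kappa> = \<alpha>\<^sup>2 + 2 * w1 * a"
  define p where "p = 2 * \<delta> * (K - 2 * w1\<^sup>2 - 2 * w2\<^sup>2)"
  have pr: "p = 2 * \<delta> * (r / 4 - w1\<^sup>2 - w2\<^sup>2)" by (simp add: p_def K)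
  have c0: "\<alpha>\<^sup>2 + 2 * w1 * a = \<kappa>" by (simp add: \<kappa>_def)
  have c1: "2 * \<alpha> * \<beta> + 2 * w1 * e + 2 * w2 * a = 0" by (rule coeffs(1))
  have c2: "\<beta>\<^sup>2 + 2 * w2 * e = \<kappa>" unfolding \<kappa>_def by (rule coeffs(2))
  have c3: "2 * \<alpha> * \<gamma> - K * a + 2 * w1 * h = 0" by (rule coeffs(3))
  have c4: "2 * \<beta> * \<gamma> - K * e + 2 * w2 * h = 0" by (rule coeffs(4))
  have c5: "\<gamma>\<^sup>2 - K * h = - (\<kappa> * r)" using coeffs(5) by (simp add: \<kappa>_def r_def)
  (* The common zero of Y and D is v = (K - 2 w2^2 : 2 w1 w2 : 2 w1), and p is the value P(v).
     The equations k1, k2 and k3 are the three coordinates of the polar of v. *)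
  have Y0: "\<alpha> * (K - 2 * w2\<^sup>2) + \<beta> * (2 * w1 * w2) + \<gamma> * (2 * w1) = 0"
    unfolding \<alpha>_def \<beta>_def \<gamma>_def by algebra
  have P0: "a * (K - 2 * w2\<^sup>2) + e * (2 * w1 * w2) + h * (2 * w1) = p"
    unfolding a_def e_def h_def p_def by algebra
  have k1: "\<kappa> * (K - 2 * w2\<^sup>2) = w1 * p"
  proof -
    have "2 * (\<kappa> * (K - 2 * w2\<^sup>2)) = 2 * (\<alpha>\<^sup>2 + 2 * w1 * a) * (K - 2 * w2\<^sup>2)
        + (2 * \<alpha> * \<beta> + 2 * w1 * e + 2 * w2 * a) * (2 * w1 * w2)
        + (2 * \<alpha> * \<gamma> - K * a + 2 * w1 * h) * (2 * w1)"
      unfolding c0 c1 c3 by simp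
    also have "\<dots> = 2 * \<alpha> * (\<alpha> * (K - 2 * w2\<^sup>2) + \<beta> * (2 * w1 * w2) + \<gamma> * (2 * w1))
        + 2 * w1 * (a * (K - 2 * w2\<^sup>2) + e * (2 * w1 * w2) + h * (2 * w1))"
      by algebra
    finally show ?thesis unfolding Y0 P0 by algebra
  qed
  have k2: "\<kappa> * (2 * w1 * w2) = w2 * p"
  proof -
    have "2 * (\<kappa> * (2 * w1 * w2)) = (2 * \<alpha> * \<beta> + 2 * w1 * e + 2 * w2 * a) * (K - 2 * w2\<^sup>2)
        + 2 * (\<beta>\<^sup>2 + 2 * w2 * e) * (2 * w1 * w2)
        + (2 * \<beta> * \<gamma> - K * e + 2 * w2 * h) * (2 * w1)"
      unfolding c1 c2 c4 by simp
    also have "\<dots> = 2 * \<beta> * (\<alpha> * (K - 2 * w2\<^sup>2) + \<beta> * (2 * w1 * w2) + \<gamma> * (2 * w1))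
        + 2 * w2 * (a * (K - 2 * w2\<^sup>2) + e * (2 * w1 * w2) + h * (2 * w1))"
      by algebra
    finally show ?thesis unfolding Y0 P0 by algebra
  qed
  have k3: "4 * \<kappa> * r * w1 = K * p"
  proof -
    have "- (4 * \<kappa> * r * w1) = (2 * \<alpha> * \<gamma> - K * a + 2 * w1 * h) * (K - 2 * w2\<^sup>2)
        + (2 * \<beta> * \<gamma> - K * e + 2 * w2 * h) * (2 * w1 * w2)
        + 2 * (\<gamma>\<^sup>2 - K * h) * (2 * w1)"
      unfolding c3 c4 c5 by simp
    also have "\<dots> = 2 * \<gamma> * (\<alpha> * (K - 2 * w2\<^sup>2) + \<beta> * (2 * w1 * w2) + \<gamma> * (2 * w1))
        - K * (a * (K - 2 * w2\<^sup>2) + e * (2 * w1 * w2) + h * (2 * w1))"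
      by algebra
    finally show ?thesis unfolding Y0 P0 by algebra
  qed
  (* If p = 0, then w has norm R / 2, and w1 = 0 or \<kappa> = 0. The coefficients of x^2, x y and y^2
     force \<delta> = 0 in the first case and m = 0 in the second. *)
  have nondeg: "p \<noteq> 0"
  proof
    assume p0: "p = 0"
    then have wr: "w1\<^sup>2 + w2\<^sup>2 = r / 4" using \<delta> by (simp add: pr)
    show False
    proof (cases "w1 = 0")
      case True
      then have "w2 * \<delta> = 0" using c1 unfolding \<alpha>_def a_def by simp
      then show False using True \<delta> wr r by simp
    next
      case False
      then have \<kappa>0: "\<kappa> = 0" using k3 p0 r by simp
      have "w1 * (\<delta> - (g - f2\<^sup>2) * w1) = 0"
        using c0 unfolding \<kappa>0 \<alpha>_def a_def by algebra
      then have d1: "\<delta> = (g - f2\<^sup>2) * w1" using False by simp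
      have "w1 * (f2 * m - w2 * (g - f2\<^sup>2)) = 0"
        using c1 d1 unfolding \<alpha>_def \<beta>_def a_def e_def by algebra
      then have d2: "f2 * m = w2 * (g - f2\<^sup>2)" using False by simp
      have "m\<^sup>2 = 0" using c2 d2 unfolding \<kappa>0 \<beta>_def e_def by algebra
      then show False using assms(3) by simp
    qed
  qed
  have \<kappa>0: "\<kappa> \<noteq> 0" and w10: "w1 \<noteq> 0" using k3 nondeg K0 by auto
  have w2: "w2 = 0"
  proof (rule ccontr)
    assume "w2 \<noteq> 0"
    have "w2 * (p - 2 * \<kappa> * w1) = 0" using k2 by algebra
    then have p: "p = 2 * \<kappa> * w1" using \<open>w2 \<noteq> 0\<close> by simp
    have "4 * \<kappa> * w1 * r = 4 * \<kappa> * w1 * (K / 2)" using k3 p by simp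
    then have "K = 2 * r" using \<kappa>0 w10 by simp
    moreover have "\<kappa> * (K - 2 * w2\<^sup>2) = \<kappa> * (2 * w1\<^sup>2)"
      using k1 unfolding p by algebra
    then have "K - 2 * w2\<^sup>2 = 2 * w1\<^sup>2" using \<kappa>0 by simp
    (* Now w1^2 + w2^2 = r, so that K = 5 r / 4 instead of 2 r. *)
    ultimately show False using K r by simp
  qed
  then show "Im w = 0" by (simp add: w2_def)
  have "\<kappa> * K\<^sup>2 = \<kappa> * (4 * r * w1\<^sup>2)" using k1 k3 w2 by algebra
  then have "K\<^sup>2 = (2 * R * \<bar>w1\<bar>)\<^sup>2" using \<kappa>0 by (simp add: r_def power_mult_distrib)
  then have "K = 2 * R * \<bar>w1\<bar>" by (rule power2_eq_imp_eq) (use K0 assms(2) in auto)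
  then show "(Re w)\<^sup>2 + R\<^sup>2 / 4 = 2 * R * \<bar>Re w\<bar>"
    by (simp add: K w2 r_def w1_def)
qed

lemma is_line_unit_normal:
  fixes d :: "complex set"
  assumes "is_line d"
  obtains n b where "norm n = 1" "d = {z. n \<bullet> z = b}"
proof -
  have "aff_dim d = DIM(complex) - 1" "affine hull d = d"
    using assms by (auto simp: is_line_def hull_same)
  then obtain a c where a: "a \<noteq> 0" "d = {z. a \<bullet> z = c}"
    by (metis aff_dim_eq_hyperplane)
  have "norm (sgn a) = 1" using a by (simp add: norm_sgn)
  moreover have "d = {z. sgn a \<bullet> z = c / norm a}"
    using a by (auto simp: sgn_div_norm field_simps)
  ultimately show ?thesis using that by blast
qed

lemma inner_frame:
  fixes u z w :: complex
  assumes "norm u = 1"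
  shows "(u * z) \<bullet> (u * w) = z \<bullet> w"
proof -
  have "(Re u)\<^sup>2 + (Im u)\<^sup>2 = 1" using assms cmod_power2[of u] by simp
  then show ?thesis by (simp add: inner_complex_def) algebra
qed

text \<open>The axis direction is parallel to \<open>Q\<close> up to sign; the unit normal \<open>u\<close> of the directrix is
  oriented so that \<open>Q\<close> is a positive multiple of it.\<close>

lemma parabola_inscribed_tangent:
  assumes "R > 0" "l > 0" "parabola_inscribed R Q l F d"
  obtains u q b where "norm u = 1" "q > 0" "Q = u * of_real q" "q\<^sup>2 + R\<^sup>2 / 4 = 2 * R * q"
    "d = {z. u \<bullet> z = b}"
proof -
  have d: "is_line d" "F \<notin> d" using assms(3) by (auto simp: parabola_inscribed_def)
  obtain n b where n: "norm n = 1" "d = {z. n \<bullet> z = b}" using is_line_unit_normal[OF d(1)] .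
  have n0: "n \<noteq> 0" using n by auto
  define w f where "w = Q / n" and "f = (F - Q) / n"
  have Qw: "Q = n * w" and Ff: "F = Q + n * f" using n0 by (simp_all add: w_def f_def)
  define b' where "b' = b - n \<bullet> Q"
  have inn: "n \<bullet> (n * z) = Re z" for z
    using inner_frame[OF n(1), of 1 z] by (simp add: inner_complex_def)
  have "Re f \<noteq> b'" using d(2) unfolding n(2) Ff b'_def by (simp add: inner_add_right inn)
  define D where "D z = R\<^sup>2 / 4 + (norm w)\<^sup>2 - 2 * (Re z * Re w + Im z * Im w)" for z
  have "inj (\<lambda>z. z / n)" using n0 by (auto simp: inj_def)
  then have "infinite ((\<lambda>z. z / n) ` ((\<lambda>\<phi>. of_real R * cis \<phi>) ` admissible R Q))"
    using infinite_admissible_vertices[OF assms(1)] by (metis finite_imageD inj_on_subset subset_UNIV)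
  moreover have "(\<lambda>z. z / n) ` ((\<lambda>\<phi>. of_real R * cis \<phi>) ` admissible R Q) \<subseteq>
    {z. norm z = R \<and> D z \<noteq> 0 \<and>
      (l\<^sup>2 / D z * (Re z - Re w) - Re f)\<^sup>2 + (l\<^sup>2 / D z * (Im z - Im w) - Im f)\<^sup>2
        = (l\<^sup>2 / D z * (Re z - Re w) - b')\<^sup>2}"
  proof (clarify, intro conjI)
    fix \<phi> assume \<phi>: "\<phi> \<in> admissible R Q"
    define z where "z = of_real R * cis \<phi> / n"
    (* The third base vertex is the one at angle \<phi> itself. *)
    have "cis (\<phi> + 2 * pi) = cis \<phi>" by (simp add: complex_eq_iff)
    then have bv: "base_vertex R \<phi> 3 = n * z"
      using n0 by (simp add: base_vertex_def z_def)
    show "norm (of_real R * cis \<phi> / n) = R" using assms(1) n by (simp add: norm_mult norm_divide)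
    note v = ss_vertex_in_frame[OF assms(1,2) \<phi> _ n(1) bv Qw, folded D_def, simplified]
    show "D (of_real R * cis \<phi> / n) \<noteq> 0" using v(1) by (simp add: z_def)
    have "ss_vertex R Q l \<phi> 3 \<in> parabola F d"
      using assms(3) \<phi> by (auto simp: parabola_inscribed_def)
    then have "dist (ss_vertex R Q l \<phi> 3) F = \<bar>n \<bullet> ss_vertex R Q l \<phi> 3 - b\<bar>"
      unfolding parabola_def n(2) by (simp add: infdist_line[OF n(1)])
    moreover have "n \<bullet> ss_vertex R Q l \<phi> 3 - b = l\<^sup>2 / D z * (Re z - Re w) - b'"
      unfolding v(2) by (simp add: inner_add_right inn b'_def)
    moreover have "ss_vertex R Q l \<phi> 3 - F = n * ((l\<^sup>2 / D z) *\<^sub>R (z - w) - f)"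
      unfolding v(2) Ff by (simp add: algebra_simps)
    then have "dist (ss_vertex R Q l \<phi> 3) F = norm ((l\<^sup>2 / D z) *\<^sub>R (z - w) - f)"
      by (simp add: dist_norm norm_mult n(1))
    ultimately have "(norm ((l\<^sup>2 / D z) *\<^sub>R (z - w) - f))\<^sup>2 = (l\<^sup>2 / D z * (Re z - Re w) - b')\<^sup>2"
      by simp
    then show "(l\<^sup>2 / D (of_real R * cis \<phi> / n) * (Re (of_real R * cis \<phi> / n) - Re w) - Re f)\<^sup>2
        + (l\<^sup>2 / D (of_real R * cis \<phi> / n) * (Im (of_real R * cis \<phi> / n) - Im w) - Im f)\<^sup>2
        = (l\<^sup>2 / D (of_real R * cis \<phi> / n) * (Re (of_real R * cis \<phi> / n) - Re w) - b')\<^sup>2"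
      unfolding z_def[symmetric] cmod_power2 by simp
  qed
  ultimately have inf: "infinite {z. norm z = R \<and> D z \<noteq> 0 \<and>
      (l\<^sup>2 / D z * (Re z - Re w) - Re f)\<^sup>2 + (l\<^sup>2 / D z * (Im z - Im w) - Im f)\<^sup>2
        = (l\<^sup>2 / D z * (Re z - Re w) - b')\<^sup>2}"
    by (rule infinite_super[rotated])
  have l2: "l\<^sup>2 > 0" using assms(2) by simp
  have w: "Im w = 0" "(Re w)\<^sup>2 + R\<^sup>2 / 4 = 2 * R * \<bar>Re w\<bar>"
    using parabola_circle_image_tangent[OF assms(1) l2 \<open>Re f \<noteq> b'\<close> inf[unfolded D_def]] by blast+
  have w0: "Re w \<noteq> 0" using w(2) assms(1) by auto
  have Qr: "Q = n * of_real (Re w)" using w(1) Qw by (simp add: complex_eq_iff)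
  show ?thesis
  proof (cases "Re w > 0")
    case True
    then show ?thesis using that[of n "Re w" b] n w Qr by simp
  next
    case False
    then show ?thesis using that[of "- n" "- Re w" "- b"] n w w0 Qr by simp
  qed
qed

section \<open>The orthocenter of a triangle inscribed in a parabola\<close>

text \<open>The chord between the parameters \<open>b\<close> and \<open>c\<close> has direction \<open>(p (b + c), k)\<close>, so every altitude
  equation is linear in the coordinates of \<open>H\<close> with the same coefficient \<open>k\<close> on the second one.
  The difference of two altitude equations thus determines the first coordinate, as a symmetric
  function of the parameters; an altitude then gives the second.\<close>

lemma orthocenter_of_parabola_triangle:
  fixes u O' H :: complex and p k t\<^sub>1 t\<^sub>2 t\<^sub>3 :: real
  assumes "norm u = 1" "p \<noteq> 0" "k \<noteq> 0" "t\<^sub>1 \<noteq> t\<^sub>2" "t\<^sub>2 \<noteq> t\<^sub>3" "t\<^sub>3 \<noteq> t\<^sub>1"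
  defines "V \<equiv> \<lambda>t. O' + u * Complex (p * t\<^sup>2) (k * t)"
    and "h \<equiv> - p * (t\<^sub>1 * t\<^sub>2 + t\<^sub>2 * t\<^sub>3 + t\<^sub>3 * t\<^sub>1) - k\<^sup>2 / p"
  shows "is_orthocenter H (V t\<^sub>1) (V t\<^sub>2) (V t\<^sub>3) \<longleftrightarrow>
    H = O' + u * Complex h (- (p * h * (t\<^sub>1 + t\<^sub>2 + t\<^sub>3) + p\<^sup>2 * (t\<^sub>1 * t\<^sub>2 * t\<^sub>3)) / k)"
proof -
  have u0: "u \<noteq> 0" using assms(1) by auto
  obtain x y where xy: "(H - O') / u = Complex x y" by (cases "(H - O') / u")
  have H: "H = O' + u * Complex x y" using u0 by (simp flip: xy)
  have alt: "(H - V a) \<bullet> (V b - V c) = (b - c) * (p * (x - p * a\<^sup>2) * (b + c) + k * (y - k * a))"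
    for a b c
  proof -
    have "H - V a = u * Complex (x - p * a\<^sup>2) (y - k * a)"
      "V b - V c = u * Complex (p * b\<^sup>2 - p * c\<^sup>2) (k * b - k * c)"
      by (simp_all add: H V_def right_diff_distrib[symmetric] complex_eq_iff)
    then have "(H - V a) \<bullet> (V b - V c)
        = (x - p * a\<^sup>2) * (p * b\<^sup>2 - p * c\<^sup>2) + (y - k * a) * (k * b - k * c)"
      by (simp only: inner_frame[OF assms(1)]) (simp add: inner_complex_def)
    also have "\<dots> = (b - c) * (p * (x - p * a\<^sup>2) * (b + c) + k * (y - k * a))" by algebra
    finally show ?thesis .
  qed
  have ph: "p * h = - (p\<^sup>2 * (t\<^sub>1 * t\<^sub>2 + t\<^sub>2 * t\<^sub>3 + t\<^sub>3 * t\<^sub>1)) - k\<^sup>2"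
    using assms(2) by (simp add: h_def field_simps power2_eq_square)
  define a where "a s b c = p * (x - p * s\<^sup>2) * (b + c) + k * (y - k * s)" for s b c
  have "is_orthocenter H (V t\<^sub>1) (V t\<^sub>2) (V t\<^sub>3) \<longleftrightarrow> a t\<^sub>1 t\<^sub>2 t\<^sub>3 = 0 \<and> a t\<^sub>2 t\<^sub>3 t\<^sub>1 = 0 \<and> a t\<^sub>3 t\<^sub>1 t\<^sub>2 = 0"
    using assms(4-6) by (simp add: is_orthocenter_def alt a_def)
  also have "\<dots> \<longleftrightarrow> x = h \<and> k * y = - (p * h * (t\<^sub>1 + t\<^sub>2 + t\<^sub>3) + p\<^sup>2 * (t\<^sub>1 * t\<^sub>2 * t\<^sub>3))"
  proof
    assume *: "a t\<^sub>1 t\<^sub>2 t\<^sub>3 = 0 \<and> a t\<^sub>2 t\<^sub>3 t\<^sub>1 = 0 \<and> a t\<^sub>3 t\<^sub>1 t\<^sub>2 = 0"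
    have "(t\<^sub>1 - t\<^sub>2) * (p * (x - h)) = a t\<^sub>2 t\<^sub>3 t\<^sub>1 - a t\<^sub>1 t\<^sub>2 t\<^sub>3"
      unfolding a_def right_diff_distrib[of p x h] ph by algebra
    then have x: "x = h" using * assms(2,4) by simp
    have "k * y = - (p * h * (t\<^sub>1 + t\<^sub>2 + t\<^sub>3) + p\<^sup>2 * (t\<^sub>1 * t\<^sub>2 * t\<^sub>3))"
      using conjunct1[OF *] ph unfolding a_def x by algebra
    with x show "x = h \<and> k * y = - (p * h * (t\<^sub>1 + t\<^sub>2 + t\<^sub>3) + p\<^sup>2 * (t\<^sub>1 * t\<^sub>2 * t\<^sub>3))" ..
  next
    assume *: "x = h \<and> k * y = - (p * h * (t\<^sub>1 + t\<^sub>2 + t\<^sub>3) + p\<^sup>2 * (t\<^sub>1 * t\<^sub>2 * t\<^sub>3))"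
    then have x: "x = h" and y: "k * y = - (p * h * (t\<^sub>1 + t\<^sub>2 + t\<^sub>3) + p\<^sup>2 * (t\<^sub>1 * t\<^sub>2 * t\<^sub>3))" by auto
    show "a t\<^sub>1 t\<^sub>2 t\<^sub>3 = 0 \<and> a t\<^sub>2 t\<^sub>3 t\<^sub>1 = 0 \<and> a t\<^sub>3 t\<^sub>1 t\<^sub>2 = 0"
      using ph y unfolding a_def x by (intro conjI; algebra)
  qed
  also have "\<dots> \<longleftrightarrow> H = O' + u * Complex h (- (p * h * (t\<^sub>1 + t\<^sub>2 + t\<^sub>3) + p\<^sup>2 * (t\<^sub>1 * t\<^sub>2 * t\<^sub>3)) / k)"
    using u0 assms(3) by (auto simp: H field_simps)
  finally show ?thesis .
qed

section \<open>Cotangents of angles in steps of sixty degrees\<close>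

lemma sin_cos_thirds:
  fixes \<alpha> :: real
  shows "sin (\<alpha> + pi / 3) = sin \<alpha> / 2 + sqrt 3 / 2 * cos \<alpha>"
    "cos (\<alpha> + pi / 3) = cos \<alpha> / 2 - sqrt 3 / 2 * sin \<alpha>"
    "sin (\<alpha> + 2 * pi / 3) = - sin \<alpha> / 2 + sqrt 3 / 2 * cos \<alpha>"
    "cos (\<alpha> + 2 * pi / 3) = - cos \<alpha> / 2 - sqrt 3 / 2 * sin \<alpha>"
proof -
  have "sin (2 * pi / 3) = sqrt 3 / 2" using sin_120' by (simp only: mult.commute)
  then show "sin (\<alpha> + pi / 3) = sin \<alpha> / 2 + sqrt 3 / 2 * cos \<alpha>"
    "cos (\<alpha> + pi / 3) = cos \<alpha> / 2 - sqrt 3 / 2 * sin \<alpha>"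
    "sin (\<alpha> + 2 * pi / 3) = - sin \<alpha> / 2 + sqrt 3 / 2 * cos \<alpha>"
    "cos (\<alpha> + 2 * pi / 3) = - cos \<alpha> / 2 - sqrt 3 / 2 * sin \<alpha>"
    by (simp_all add: sin_add cos_add sin_60 cos_60 cos_120)
qed

lemma sin_cos_triple:
  fixes \<alpha> :: real
  shows "sin (3 * \<alpha>) = 3 * sin \<alpha> * (cos \<alpha>)\<^sup>2 - (sin \<alpha>)^3"
    "cos (3 * \<alpha>) = (cos \<alpha>)^3 - 3 * cos \<alpha> * (sin \<alpha>)\<^sup>2"
proof -
  have "sin (2 * \<alpha> + \<alpha>) = 3 * sin \<alpha> * (cos \<alpha>)\<^sup>2 - (sin \<alpha>)^3"
    "cos (2 * \<alpha> + \<alpha>) = (cos \<alpha>)^3 - 3 * cos \<alpha> * (sin \<alpha>)\<^sup>2"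
    unfolding sin_add cos_add sin_double cos_double by algebra+
  then show "sin (3 * \<alpha>) = 3 * sin \<alpha> * (cos \<alpha>)\<^sup>2 - (sin \<alpha>)^3"
    "cos (3 * \<alpha>) = (cos \<alpha>)^3 - 3 * cos \<alpha> * (sin \<alpha>)\<^sup>2"
    by simp_all
qed

text \<open>The three cotangents are the roots of \<open>t\<^sup>3 - 3 T t\<^sup>2 - 3 t + T\<close> with \<open>T = cot (3 \<alpha>)\<close>, because
  the triple angle formula makes \<open>cot (3 \<theta>) = T\<close> a cubic equation for \<open>cot \<theta>\<close>, and all three angles
  satisfy it. The proof evaluates the symmetric functions directly.\<close>

lemma cot_thirds:
  fixes \<alpha> :: real
  assumes nz: "\<And>i. i \<in> {1..3} \<Longrightarrow> sin (\<alpha> + pi * real i / 3) \<noteq> 0"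
  defines "t \<equiv> \<lambda>i. cot (\<alpha> + pi * real i / 3)"
  shows "t 1 * t 2 + t 2 * t 3 + t 3 * t 1 = - 3" "t 1 + t 2 + t 3 = 3 * cot (3 * \<alpha>)"
    "t 1 * t 2 * t 3 = - cot (3 * \<alpha>)" "t 1 \<noteq> t 2" "t 2 \<noteq> t 3" "t 3 \<noteq> t 1"
proof -
  define S C w where "S = sin \<alpha>" and "C = cos \<alpha>" and "w = sqrt (3::real)"
  have w: "w\<^sup>2 = 3" "w \<noteq> 0" by (simp_all add: w_def)
  have SC: "S\<^sup>2 + C\<^sup>2 = 1" by (simp add: S_def C_def)
  define s1 c1 s2 c2 where "s1 = S / 2 + w / 2 * C" and "c1 = C / 2 - w / 2 * S"
    and "s2 = - S / 2 + w / 2 * C" and "c2 = - C / 2 - w / 2 * S"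
  have nz': "s1 \<noteq> 0" "s2 \<noteq> 0" "S \<noteq> 0"
    using nz[of 1] nz[of 2] nz[of 3]
    by (simp_all add: sin_cos_thirds s1_def s2_def S_def C_def w_def mult.commute[of pi])
  have t: "t 1 = c1 / s1" "t 2 = c2 / s2" "t 3 = C / S"
    by (simp_all add: t_def cot_def sin_cos_thirds s1_def s2_def c1_def c2_def S_def C_def w_def
        mult.commute[of pi])
  have d1: "2 * s1 = S + w * C" "2 * c1 = C - w * S" "2 * s2 = w * C - S" "2 * c2 = - C - w * S"
    by (simp_all add: s1_def s2_def c1_def c2_def)
  have sin3: "sin (3 * \<alpha>) = 4 * (s1 * s2 * S)"
    using d1 w unfolding sin_cos_triple S_def[symmetric] C_def[symmetric] by algebra
  have cos3: "cos (3 * \<alpha>) = - 4 * (c1 * c2 * C)"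
    using d1 w unfolding sin_cos_triple S_def[symmetric] C_def[symmetric] by algebra
  have cot3: "cot (3 * \<alpha>) = - (c1 * c2 * C) / (s1 * s2 * S)"
    unfolding cot_def sin3 cos3 using nz' by (simp add: field_simps)
  have "c1 * c2 * S + c2 * C * s1 + C * c1 * s2 = - 3 * (s1 * s2 * S)"
    using d1 w by algebra
  then show "t 1 * t 2 + t 2 * t 3 + t 3 * t 1 = - 3"
    unfolding t using nz' by (simp add: field_simps)
  have "c1 * s2 * S + s1 * c2 * S + s1 * s2 * C = - 3 * (c1 * c2 * C)"
    using d1 w by algebra
  then show "t 1 + t 2 + t 3 = 3 * cot (3 * \<alpha>)"
    unfolding t cot3 using nz' by (simp add: field_simps)
  show "t 1 * t 2 * t 3 = - cot (3 * \<alpha>)"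
    unfolding t cot3 by simp
  (* These are, up to sign, twice the sines of the differences of the angles. *)
  have "2 * (c1 * s2 - c2 * s1) = w" "2 * (c2 * S - C * s2) = - w" "2 * (C * s1 - c1 * S) = w"
    using d1 w SC by algebra+
  then show "t 1 \<noteq> t 2" "t 2 \<noteq> t 3" "t 3 \<noteq> t 1"
    unfolding t using nz' w by (auto simp: frac_eq_eq)
qed

section \<open>The locus of the orthocenter\<close>

text \<open>The condition on \<open>q\<close> makes \<open>D\<close> equal to \<open>4 R q sin\<^sup>2 \<theta>\<close>, where \<open>\<theta>\<close> is half the angle between
  the base vertex and \<open>u\<close>, so that the vertices become rational in \<open>cot \<theta>\<close>. It also gives
  \<open>16 p\<^sup>2 = 3 k\<^sup>2\<close>, and this ratio makes the second coordinate \<open>3 k T / 2\<close> of the orthocenter a nonzero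
  multiple of \<open>T = cot (3 \<alpha>)\<close>: the orthocenter really moves.\<close>

lemma orthocenter_locus_tangent:
  fixes u :: complex
  assumes "R > 0" "l > 0" "norm u = 1" "q > 0" "q\<^sup>2 + R\<^sup>2 / 4 = 2 * R * q"
  shows "\<exists>h. orthocenter_locus R (u * of_real q) l = {z. u \<bullet> z = h}"
proof -
  define Q where "Q = u * of_real q"
  define k p where "k = l\<^sup>2 / (2 * q)" and "p = k * (1 - q / R) / 2"
  have k: "k > 0" using assms by (simp add: k_def)
  have "(1 - q / R)\<^sup>2 = 3 / 4"
    using assms(1,5) by (simp add: field_simps power2_eq_square)
  then have p2: "16 * p\<^sup>2 = 3 * k\<^sup>2" by (simp add: p_def power_mult_distrib power_divide)
  then have p: "p \<noteq> 0" using k by auto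
  define X where "X = - p * (- 3) - k\<^sup>2 / p"
  define O' where "O' = Q + u * of_real (p - k)"
  define \<psi> where "\<psi> = Arg u"
  have u: "u = cis \<psi>" using assms(3) unfolding \<psi>_def by (metis rcis_cmod_Arg rcis_def mult_1 of_real_1)
  define \<alpha> where "\<alpha> \<phi> = (\<phi> - \<psi>) / 2" for \<phi>
  define t where "t \<phi> i = cot (\<alpha> \<phi> + pi * real i / 3)" for \<phi> and i :: nat
  have base: "base_vertex R \<phi> i = u * (of_real R * cis (2 * (\<alpha> \<phi> + pi * real i / 3)))" for \<phi> i
  proof -
    have "\<psi> + 2 * (\<alpha> \<phi> + pi * real i / 3) = \<phi> + 2 * pi * real i / 3" by (simp add: \<alpha>_def field_simps)
    then show ?thesis by (simp add: base_vertex_def u cis_mult mult.left_commute[of "cis \<psi>"])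
  qed
  have K: "R\<^sup>2 / 4 + q\<^sup>2 - 2 * (R * cos (2 * \<theta>) * q) = 4 * R * q * (sin \<theta>)\<^sup>2" for \<theta>
    using assms(5) unfolding cos_double_sin by algebra
  have adm: "\<phi> \<in> admissible R Q \<longleftrightarrow> (\<forall>i\<in>{1..3}. sin (\<alpha> \<phi> + pi * real i / 3) \<noteq> 0)" for \<phi>
  proof -
    have "Q \<in> base_circle R \<phi> i \<longleftrightarrow> sin (\<alpha> \<phi> + pi * real i / 3) = 0" for i
    proof -
      define \<theta> where "\<theta> = \<alpha> \<phi> + pi * real i / 3"
      have "dist (base_vertex R \<phi> i) Q = norm (u * (of_real R * cis (2 * \<theta>) - of_real q))"
        by (simp add: dist_norm base Q_def \<theta>_def right_diff_distrib)
      also have "\<dots> = norm (of_real R * cis (2 * \<theta>) - of_real q)" by (simp add: norm_mult assms(3))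
      finally have d: "dist (base_vertex R \<phi> i) Q = norm (of_real R * cis (2 * \<theta>) - of_real q)" .
      have "Q \<in> base_circle R \<phi> i \<longleftrightarrow>
          (dist (base_vertex R \<phi> i) Q)\<^sup>2 = (R * sin (pi / 3))\<^sup>2"
        using assms(1) by (simp add: base_circle_def sin_60 power2_eq_iff_nonneg)
      also have "\<dots> \<longleftrightarrow> R\<^sup>2 / 4 + q\<^sup>2 - 2 * (R * cos (2 * \<theta>) * q) = 0"
        unfolding d norm_diff_square base_radius_square using assms(1,4)
        by (simp add: norm_mult field_simps)
      also have "\<dots> \<longleftrightarrow> sin \<theta> = 0" unfolding K using assms(1,4) by simp
      finally show ?thesis by (simp add: \<theta>_def)
    qed
    then show ?thesis by (simp add: admissible_def)
  qed
  have vertex: "ss_vertex R Q l \<phi> i = O' + u * Complex (p * (t \<phi> i)\<^sup>2) (k * t \<phi> i)"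
    if \<phi>: "\<phi> \<in> admissible R Q" and i: "i \<in> {1..3}" for \<phi> i
  proof -
    define \<theta> where "\<theta> = \<alpha> \<phi> + pi * real i / 3"
    define s where "s = sin \<theta>"
    have s: "s \<noteq> 0" using \<phi> i by (simp add: adm s_def \<theta>_def)
    have t: "t \<phi> i = cos \<theta> / s" by (simp add: t_def \<theta>_def s_def cot_def)
    have "(cos \<theta>)\<^sup>2 = 1 - s\<^sup>2" by (simp add: s_def cos_squared_eq)
    then have t2: "(t \<phi> i)\<^sup>2 = 1 / s\<^sup>2 - 1" using s by (simp add: t power_divide diff_divide_distrib)
    have "ss_vertex R Q l \<phi> i
        = Q + u * ((l\<^sup>2 / (4 * R * q * s\<^sup>2)) *\<^sub>R (of_real R * cis (2 * \<theta>) - of_real q))"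
      using ss_vertex_in_frame(2)[OF assms(1,2) \<phi> i assms(3) base Q_def] K[of \<theta>] assms(1)
      by (simp add: \<theta>_def s_def)
    moreover have "(l\<^sup>2 / (4 * R * q * s\<^sup>2)) *\<^sub>R (of_real R * cis (2 * \<theta>) - of_real q)
        = of_real (p - k) + Complex (p * (t \<phi> i)\<^sup>2) (k * t \<phi> i)"
    proof -
      have "l\<^sup>2 / (4 * R * q * s\<^sup>2) * (R * cos (2 * \<theta>) - q) = p - k + p * (t \<phi> i)\<^sup>2"
        unfolding t2 p_def k_def cos_double_sin s_def[symmetric] using s assms(1,4)
        by (simp add: field_simps)
      moreover have "l\<^sup>2 / (4 * R * q * s\<^sup>2) * (R * sin (2 * \<theta>)) = k * t \<phi> i"
        unfolding t k_def sin_double s_def[symmetric] using s assms(1,4)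
        by (simp add: field_simps power2_eq_square)
      ultimately show ?thesis by (simp add: complex_eq_iff)
    qed
    ultimately show ?thesis by (simp only: O'_def distrib_left add.assoc)
  qed
  have pX: "p * X = 3 * p\<^sup>2 - k\<^sup>2" using p by (simp add: X_def field_simps power2_eq_square)
  have ortho: "is_orthocenter H (ss_vertex R Q l \<phi> 1) (ss_vertex R Q l \<phi> 2) (ss_vertex R Q l \<phi> 3)
      \<longleftrightarrow> H = O' + u * Complex X (3 / 2 * k * cot (3 * \<alpha> \<phi>))"
    if \<phi>: "\<phi> \<in> admissible R Q" for \<phi> H
  proof -
    have nz: "sin (\<alpha> \<phi> + pi * real i / 3) \<noteq> 0" if "i \<in> {1..3}" for i
      using \<phi> that by (simp add: adm)
    have cots: "t \<phi> 1 * t \<phi> 2 + t \<phi> 2 * t \<phi> 3 + t \<phi> 3 * t \<phi> 1 = - 3"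
      "t \<phi> 1 + t \<phi> 2 + t \<phi> 3 = 3 * cot (3 * \<alpha> \<phi>)"
      "t \<phi> 1 * t \<phi> 2 * t \<phi> 3 = - cot (3 * \<alpha> \<phi>)"
      "t \<phi> 1 \<noteq> t \<phi> 2" "t \<phi> 2 \<noteq> t \<phi> 3" "t \<phi> 3 \<noteq> t \<phi> 1"
      unfolding t_def by (rule cot_thirds, fact nz)+
    have y: "- (p * X * (3 * cot (3 * \<alpha> \<phi>)) + p\<^sup>2 * (- cot (3 * \<alpha> \<phi>))) / k
        = 3 / 2 * k * cot (3 * \<alpha> \<phi>)"
    proof -
      have "2 * - (p * X * (3 * cot (3 * \<alpha> \<phi>)) + p\<^sup>2 * (- cot (3 * \<alpha> \<phi>)))
          = 3 * k * k * cot (3 * \<alpha> \<phi>)"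
        unfolding pX using p2 by algebra
      then show ?thesis using k by (simp add: field_simps)
    qed
    show ?thesis
      using orthocenter_of_parabola_triangle[OF assms(3) p less_imp_neq[OF k, symmetric]
          cots(4-6), of H O']
      unfolding cots(1-3) X_def[symmetric] y
      using \<phi> by (simp add: vertex)
  qed
  have surj: "\<exists>\<phi>\<in>admissible R Q. cot (3 * \<alpha> \<phi>) = T" for T
  proof -
    (* This choice makes cot (3 a) = tan (arctan T) and keeps a in (0, pi / 3), so that no
       a + i pi / 3 is a multiple of pi. *)
    define a where "a = (pi / 2 - arctan T) / 3"
    have a: "0 < a" "a < pi / 3" using arctan_bounded[of T] by (auto simp: a_def)
    have \<alpha>: "\<alpha> (2 * a + \<psi>) = a" by (simp add: \<alpha>_def)
    have "sin (a + pi * real i / 3) \<noteq> 0" if "i \<in> {1..3}" for i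
    proof -
      have "i = 1 \<or> i = 2 \<or> i = 3" using that by auto
      moreover have "sin (a + pi / 3) > 0" by (rule sin_gt_zero) (use a in auto)
      moreover have "sin (a + pi * 2 / 3) > 0" by (rule sin_gt_zero) (use a in auto)
      moreover have "sin a > 0" by (rule sin_gt_zero) (use a in auto)
      ultimately show ?thesis by auto
    qed
    then have "2 * a + \<psi> \<in> admissible R Q" by (simp add: adm \<alpha>)
    moreover have "3 * a = pi / 2 - arctan T" by (simp add: a_def)
    then have "cot (3 * a) = tan (arctan T)"
      unfolding tan_def cot_def by (simp only: sin_diff cos_diff) simp
    then have "cot (3 * \<alpha> (2 * a + \<psi>)) = T" unfolding \<alpha> by (simp add: tan_arctan)
    ultimately show ?thesis by blast
  qed
  have u0: "u \<noteq> 0" using assms(3) by auto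
  have "u \<bullet> z = u \<bullet> O' + X \<longleftrightarrow> (\<exists>T. z = O' + u * Complex X (3 / 2 * k * T))" for z
  proof -
    obtain x y where "(z - O') / u = Complex x y" by (cases "(z - O') / u")
    then have z: "z = O' + u * Complex x y" using u0 by (simp add: field_simps)
    have "u \<bullet> (u * Complex x y) = x"
      using inner_frame[OF assms(3), of 1 "Complex x y"] by (simp add: inner_complex_def)
    then have "u \<bullet> z = u \<bullet> O' + x" by (simp add: z inner_add_right)
    moreover have "\<exists>T. y = 3 / 2 * k * T"
      using k by (intro exI[of _ "2 * y / (3 * k)"]) simp
    ultimately show ?thesis using u0 by (auto simp: z)
  qed
  moreover have "orthocenter_locus R Q l = {H. \<exists>T. H = O' + u * Complex X (3 / 2 * k * T)}"
    unfolding orthocenter_locus_def using ortho surj by (auto; metis)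
  ultimately have "orthocenter_locus R Q l = {z. u \<bullet> z = u \<bullet> O' + X}" by simp
  then show ?thesis unfolding Q_def by blast
qed

lemma hyperplanes_affine_parallel:
  fixes u :: "'a::euclidean_space"
  assumes "norm u = 1"
  shows "affine_parallel {z. u \<bullet> z = a} {z. u \<bullet> z = b}"
proof -
  have uu: "u \<bullet> u = 1" using assms by (simp add: dot_square_norm)
  have "{z. u \<bullet> z = b} = (\<lambda>x. (b - a) *\<^sub>R u + x) ` {z. u \<bullet> z = a}"
  proof safe
    fix z assume "b = u \<bullet> z"
    then show "z \<in> (\<lambda>x. (u \<bullet> z - a) *\<^sub>R u + x) ` {z. u \<bullet> z = a}"
      by (intro image_eqI[of _ _ "z - (u \<bullet> z - a) *\<^sub>R u"]) (simp_all add: inner_diff_right uu)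
  qed (simp add: inner_add_right uu)
  then show ?thesis unfolding affine_parallel_def by blast
qed

theorem corollary3:
  fixes R l :: real and Q F :: complex and d :: "complex set"
  assumes "R > 0" and "l > 0"
    and "parabola_inscribed R Q l F d"
  shows "is_line (orthocenter_locus R Q l) \<and> affine_parallel (orthocenter_locus R Q l) d"
proof -
  obtain u q b where u: "norm u = 1" and q: "q > 0" "q\<^sup>2 + R\<^sup>2 / 4 = 2 * R * q"
    and Q: "Q = u * of_real q" and d: "d = {z. u \<bullet> z = b}"
    using parabola_inscribed_tangent[OF assms] by metis
  obtain h where "orthocenter_locus R Q l = {z. u \<bullet> z = h}"
    using orthocenter_locus_tangent[OF assms(1,2) u q] Q by blast
  then show ?thesis
    using is_line_hyperplane[OF u] hyperplanes_affine_parallel[OF u] d by simp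
qed

end
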